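(* Let $G$ be a graph with $\delta(G) \ge (1-d)v(G)$ where $d=\frac{7-\sqrt{21}}{14}$. If $O=(x_1,x_2,x_3)\in \mathcal{OK}_3(G)$, then $w_{G,1}(O) \le 1$.
   Context: $\mathcal{K}_\ell(G,S)$ is the set of $\ell$-cliques of $G$ containing the vertex set $S$; $\mathcal{OK}_r(G)$ is the set of tuples $(v_1,\ldots,v_r)$ of distinct vertices spanning a clique. For $(v_1,\ldots,v_r)\in\mathcal{OK}_r(G)$, $r\in\{2,3,4\}$, $W(v_1,\ldots,v_r)=\prod_{i=2}^r \frac{1}{|\mathcal{K}_{i+1}(G,\{v_1,\ldots,v_i\})|}$. For $O=(x_1,x_2,x_3)\in\mathcal{OK}_3(G)$, $\mathcal{OK}_5(G,O)$ is the set of $(v_1,\ldots,v_5)\in\mathcal{OK}_5(G)$ in which $x_1,x_2,x_3$ appears as a (not necessarily consecutive) subsequence; for such $K$, $\psi_K(O)=+\frac13$ if $|\{x_1,x_2,x_3\}\cap\{v_1,v_2\}|\in\{0,2\}$ and $-\frac16$ if it equals $1$. Define $w_G(O)=\frac12\sum_{K=(v_1,\ldots,v_5)\in\mathcal{OK}_5(G,O)} W(v_1,\ldots,v_4)\,\psi_K(O)$ and $w_{G,1}(O)=1-6\,|\mathcal{K}_3(G,\{x_1,x_2\})|\,w_G(O)$. *)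

theory Defs
  imports Complex_Main "HOL-Library.Ramsey" "HOL-Library.Sublist"
begin

text \<open>A finite simple graph is a vertex set \<open>V\<close> with a set \<open>E\<close> of two-element subsets of \<open>V\<close>,
  the representation for which \<^const>\<open>clique\<close> is stated. Tuples of vertices are lists.\<close>

definition simple_graph :: "'a set \<Rightarrow> 'a set set \<Rightarrow> bool" where
  "simple_graph V E \<longleftrightarrow> finite V \<and> E \<subseteq> [V]\<^bsup>2\<^esup>"

definition degree :: "'a set \<Rightarrow> 'a set set \<Rightarrow> 'a \<Rightarrow> nat" where
  "degree V E v = card {u \<in> V. {u, v} \<in> E}"

text \<open>Unspecified when \<open>V\<close> is empty.\<close>

definition min_degree :: "'a set \<Rightarrow> 'a set set \<Rightarrow> nat" where
  "min_degree V E = Min (degree V E ` V)"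

definition cliques_containing :: "'a set \<Rightarrow> 'a set set \<Rightarrow> nat \<Rightarrow> 'a set \<Rightarrow> 'a set set" where
  "cliques_containing V E l S = {K \<in> [V]\<^bsup>l\<^esup>. clique K E \<and> S \<subseteq> K}"

definition ordered_cliques :: "'a set \<Rightarrow> 'a set set \<Rightarrow> nat \<Rightarrow> 'a list set" where
  "ordered_cliques V E r =
     {vs. length vs = r \<and> distinct vs \<and> set vs \<subseteq> V \<and> clique (set vs) E}"

definition ordered_cliques_over :: "'a set \<Rightarrow> 'a set set \<Rightarrow> nat \<Rightarrow> 'a list \<Rightarrow> 'a list set" where
  "ordered_cliques_over V E r xs = {vs \<in> ordered_cliques V E r. subseq xs vs}"

text \<open>The weight \<open>W(v\<^sub>1,\<dots>,v\<^sub>r)\<close>, intended for ordered cliques with \<open>r \<in> {2,3,4}\<close>.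
  In \<open>w_G\<close> below it is applied to the first four vertices of an ordered 5-clique, so every
  denominator there is positive.\<close>

definition W :: "'a set \<Rightarrow> 'a set set \<Rightarrow> 'a list \<Rightarrow> real" where
  "W V E vs =
     (\<Prod>i = 2..length vs. 1 / real (card (cliques_containing V E (i + 1) (set (take i vs)))))"

text \<open>The first argument is the ordered 5-clique, the second the ordered triangle;
  the intersection has cardinality 0, 1 or 2.\<close>

definition psi :: "'a list \<Rightarrow> 'a list \<Rightarrow> real" where
  "psi vs xs = (if card (set xs \<inter> set (take 2 vs)) \<in> {0, 2} then 1 / 3 else - 1 / 6)"

definition w_G :: "'a set \<Rightarrow> 'a set set \<Rightarrow> 'a list \<Rightarrow> real" where
  "w_G V E xs = 1 / 2 * (\<Sum>vs \<in> ordered_cliques_over V E 5 xs. W V E (take 4 vs) * psi vs xs)"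

definition w_G1 :: "'a set \<Rightarrow> 'a set set \<Rightarrow> 'a list \<Rightarrow> real" where
  "w_G1 V E xs = 1 - 6 * real (card (cliques_containing V E 3 (set (take 2 xs)))) * w_G V E xs"

end

theory Submission
  imports Defs
begin

text \<open>Writing \<open>n(S)\<close> for the number of common neighbours of a clique \<open>S\<close>, the weight \<open>W\<close> of
  a 4-clique is a product of three reciprocals \<open>1 / n\<close>. Grouping the ordered 5-cliques over
  \<open>(x\<^sub>1, x\<^sub>2, x\<^sub>3)\<close> by the remaining two vertices \<open>y, z\<close> (in their order of appearance) gives ten
  products for each pair \<open>(y, z)\<close>: four with \<open>\<psi> = 1/3\<close> and six with \<open>\<psi> = -1/6\<close>, the latter
  pairwise equal because \<open>W\<close> is symmetric in its first two arguments. Already the sum over a single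
  pair is nonnegative. The numbers \<open>n\<close> obey the inequalities
  \<open>n(S \<union> T) + n(S \<inter> T) \<ge> n(S) + n(T)\<close> and \<open>n(S \<union> {v}) \<ge> n(S) - d |V|\<close>, and in the extremal case
  the claim becomes a cubic inequality with a double root, exactly because \<open>7 d (1 - d) = 1\<close>.\<close>

section \<open>Real inequalities for normalised counts\<close>

text \<open>With \<open>q = n{x\<^sub>1, y}\<close> as unit of length, \<open>a = n{x\<^sub>1, x\<^sub>2}\<close>, \<open>p = n{y, z}\<close>,
  \<open>c = n{x\<^sub>1, x\<^sub>2, y}\<close>, \<open>r = n{x\<^sub>1, y, z}\<close>, \<open>s = n{x\<^sub>1, x\<^sub>2, y, z}\<close> and \<open>h = d / (1 - 2 d)\<close>. The second
  bound is attained at \<open>a = p = 1 + h\<close>, \<open>c = r = s = 1\<close>.\<close>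

lemma local_weight_bound:
  fixes h a p c r s :: real
  assumes h: "0 < h" "3 * h * (1 + h) = 1"
    and "0 < a" "0 < p" and a: "a \<le> 1 + h" and p: "p \<le> 1 + h"
    and c: "a - h \<le> c" "1 - h \<le> c"
    and r: "p - h \<le> r" "1 - h \<le> r"
    and s: "c + r - 1 \<le> s"
  shows "a * (a - 1) / c \<le> 1"
    and "a * (a - 1) * (1 / c + 1 / s) + a\<^sup>2 * c / (r * s) * (1 - 1 / p) \<le> 1"
proof -
  have h3: "h < 27 / 100"
  proof (rule ccontr)
    assume "\<not> h < 27 / 100"
    then have "(27/100) * (127/100) \<le> h * (1 + h)"
      by (intro mult_mono) auto
    then show False using h by (simp add: algebra_simps)
  qed
  have pos: "0 < c" "0 < r" "0 < s" using c r s h3 by linarith+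
  \<comment> \<open>Equality holds at \<open>a = 1 + h\<close>: the right side minus the left is
    \<open>1 + h - a\<close> times \<open>(a + h) * x - (1 + h) * h\<close>.\<close>
  have step: "a * (a - 1) * x \<le> (1 + h) * h * (x + (a - h) - 1)"
    if "1 < a" and x: "1 - h \<le> x" "x \<le> 1" for x
  proof -
    have "(1 + h) * h = 1 / 3" using h by (simp add: algebra_simps)
    also have "1 / 3 \<le> 1 * (1 - h)" using h3 by simp
    also have "\<dots> \<le> (a + h) * x" using that h h3 by (intro mult_mono) auto
    finally have "(1 + h - a) * ((1 + h) * h) \<le> (1 + h - a) * ((a + h) * x)"
      using a by (intro mult_left_mono) auto
    then show ?thesis by (simp add: algebra_simps power2_eq_square)
  qed
  have c1: "a * (a - 1) / c \<le> 1 / 3" if "1 < a"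
  proof -
    have "a * (a - 1) \<le> (1 + h) * h * (a - h)" using step[of 1] that h by simp
    also have "\<dots> \<le> (1 + h) * h * c" using c h by (intro mult_left_mono) auto
    also have "(1 + h) * h = 1 / 3" using h by (simp add: algebra_simps)
    finally show ?thesis using pos by (simp add: field_simps)
  qed
  have s1: "a * (a - 1) / s \<le> 1 / (3 * x)" if "1 < a" "1 - h \<le> x" "x \<le> 1" "x \<le> r" for x
  proof -
    have "a * (a - 1) * x \<le> (1 + h) * h * (x + (a - h) - 1)" using step that by simp
    also have "\<dots> \<le> (1 + h) * h * s" using c s h that by (intro mult_left_mono) auto
    also have "(1 + h) * h = 1 / 3" using h by (simp add: algebra_simps)
    finally show ?thesis using pos that h3 by (simp add: field_simps)
  qed
  have neg: "a * (a - 1) \<le> 0" if "a \<le> 1" using that \<open>0 < a\<close> by (simp add: mult_nonneg_nonpos)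
  show "a * (a - 1) / c \<le> 1"
  proof (cases "a \<le> 1")
    case True
    then have "a * (a - 1) / c \<le> 0" using neg pos by (simp add: divide_nonpos_pos)
    then show ?thesis by linarith
  next
    case False
    then show ?thesis using c1 by linarith
  qed
  have split: "a * (a - 1) * (1 / c + 1 / s) = a * (a - 1) / c + a * (a - 1) / s"
    by (simp add: distrib_left)
  have negcs: "a * (a - 1) * (1 / c + 1 / s) \<le> 0" if "a \<le> 1"
    by (rule mult_nonpos_nonneg[OF neg[OF that]]) (use pos in simp)
  show "a * (a - 1) * (1 / c + 1 / s) + a\<^sup>2 * c / (r * s) * (1 - 1 / p) \<le> 1"
  proof (cases "p \<le> 1")
    case True
    then have 1: "a\<^sup>2 * c / (r * s) * (1 - 1 / p) \<le> 0"
      using pos \<open>0 < p\<close> by (intro mult_nonneg_nonpos) auto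
    show ?thesis
    proof (cases "a \<le> 1")
      case True
      then show ?thesis using 1 negcs by linarith
    next
      case False
      have "a * (a - 1) * (1 / c + 1 / s) \<le> 1 / 3 + 1 / (3 * (1 - h))"
        unfolding split using c1 s1[of "1 - h"] False r(2) h(1) by linarith
      also have "\<dots> \<le> 1" using h3 by (simp add: field_simps)
      finally show ?thesis using 1 by linarith
    qed
  next
    case p1: False
    \<comment> \<open>\<open>x\<close> is the lower bound that \<open>p\<close> gives for
      \<open>r\<close>; the upper bound on \<open>p\<close> becomes
      \<open>x \<le> 1\<close>.\<close>
    define x where "x = p - h"
    have x: "1 - h \<le> x" "x \<le> 1" "x \<le> r" using p1 p r by (auto simp: x_def)
    have x0: "0 < x" "0 < x - h" using x h3 by linarith+
    have rx: "1 / r \<le> 1 / x" using x x0 by (intro divide_left_mono) auto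
    have px: "1 - 1 / p = (x + h - 1) / (x + h)" using \<open>0 < p\<close> by (simp add: x_def field_simps)
    have px0: "0 \<le> (x + h - 1) / (x + h)" using x x0 h by simp
    show ?thesis
    proof (cases "a \<le> 1")
      case a1: True
      \<comment> \<open>As \<open>x \<le> 1\<close>, the bound \<open>c / (c + x - 1)\<close>
        decreases in \<open>c\<close>, so the worst case is the least admissible \<open>c\<close>,
        here \<open>1 - h\<close>.\<close>
      have cs: "c / s \<le> (1 - h) / (x - h)"
      proof -
        have "c * (x - h) = (1 - h) * (c + x - 1) + (x - 1) * (c - (1 - h))" by (simp add: algebra_simps)
        also have "\<dots> \<le> (1 - h) * (c + x - 1)" using x c by (simp add: mult_nonpos_nonneg)
        also have "\<dots> \<le> (1 - h) * s" using s x h3 by (intro mult_left_mono) auto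
        finally show ?thesis using pos x0 by (simp add: field_simps)
      qed
      have "a\<^sup>2 * c / (r * s) * (1 - 1 / p) = a\<^sup>2 * (c / s) * (1 / r) * ((x + h - 1) / (x + h))"
        using px by simp
      also have "\<dots> \<le> 1 * ((1 - h) / (x - h)) * (1 / x) * ((x + h - 1) / (x + h))"
        using cs rx pos x x0 a1 \<open>0 < a\<close> px0 h3
        by (intro mult_mono mult_nonneg_nonneg power_le_one) auto
      also have "\<dots> \<le> 1"
      proof -
        have "(1 - h) * (x + h - 1) \<le> (1 - h) * h" using x h3 by (intro mult_left_mono) auto
        also have "\<dots> \<le> (1 - h) * (1 - 2 * h)" using h3 by (intro mult_left_mono) auto
        also have "\<dots> \<le> x * (x - h)" using x h3 by (intro mult_mono) auto
        also have "\<dots> \<le> x * (x - h) * (x + h)" 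
          using mult_left_mono[of 1 "x + h" "x * (x - h)"] x x0 by simp
        finally show ?thesis using x0 h by (simp add: divide_simps mult_ac)
      qed
      finally show ?thesis using negcs[OF a1] by linarith
    next
      case a1: False
      \<comment> \<open>For \<open>a > 1\<close> the sharper of the two lower bounds for
        \<open>c\<close> is \<open>a - h\<close>.\<close>
      define C where "C = a - h"
      have C: "1 - h \<le> C" "C \<le> 1" "C \<le> c" using a1 a c by (auto simp: C_def)
      have Cx: "0 < C + x - 1" using C x h3 by linarith
      have cs: "c / s \<le> C / (C + x - 1)"
      proof -
        have "c * (C + x - 1) = C * (c + x - 1) + (x - 1) * (c - C)" by (simp add: algebra_simps)
        also have "\<dots> \<le> C * (c + x - 1)" using x C by (simp add: mult_nonpos_nonneg)
        also have "\<dots> \<le> C * s" using s x C h3 by (intro mult_left_mono) auto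
        finally show ?thesis using pos Cx by (simp add: field_simps)
      qed
      \<comment> \<open>reduces to the extremal values \<open>a = 1 + h\<close>, \<open>C = 1\<close>\<close>
      have aC: "a\<^sup>2 * (C / (C + x - 1)) \<le> (1 + h)\<^sup>2 / x"
      proof -
        define A where "A = 1 + h"
        \<comment> \<open>The common shortfall from the extremal point: \<open>a = A - al\<close>
          and \<open>C = 1 - al\<close>. The fact \<open>*\<close> below makes the loss in
          \<open>a\<close> outweigh the change in \<open>C / (C + x - 1)\<close>.\<close>
        define al where "al = 1 - C"
        have al: "0 \<le> al" "al \<le> h" using C by (auto simp: al_def)
        have xu: "1 - x \<le> h" "0 \<le> 1 - x" using x by auto
        have "A * (1 - x) \<le> A * h" using xu h by (intro mult_left_mono) (auto simp: A_def)
        also have "\<dots> = 1 / 3" using h by (simp add: A_def algebra_simps)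
        also have "\<dots> \<le> C + x - 1" using C x h3 by linarith
        also have "\<dots> \<le> C * x" using xu al mult_nonneg_nonneg[of al "1 - x"]
          by (simp add: al_def algebra_simps)
        finally have *: "A * (1 - x) \<le> C * x" .
        have "(A - al)\<^sup>2 = A * (A - al) - al * (A - al)" by (simp add: power2_eq_square algebra_simps)
        also have "\<dots> \<le> A * (A - al)" using al h by (simp add: A_def)
        finally have "(A - al)\<^sup>2 * (C * x) \<le> A * (A - al) * (C * x)"
          using C x h3 by (intro mult_right_mono) auto
        also have "\<dots> = A\<^sup>2 * (C + x - 1) + A * al * (A * (1 - x) - C * x)"
          by (simp add: al_def algebra_simps power2_eq_square)
        also have "\<dots> \<le> A\<^sup>2 * (C + x - 1)"
          using * al h by (simp add: mult_nonneg_nonpos A_def)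
        finally have "a\<^sup>2 * (C * x) \<le> (1 + h)\<^sup>2 * (C + x - 1)"
          by (simp add: A_def al_def C_def algebra_simps)
        then show ?thesis using Cx x0 by (simp add: field_simps)
      qed
      have "a\<^sup>2 * c / (r * s) * (1 - 1 / p) = a\<^sup>2 * (c / s) * (1 / r) * ((x + h - 1) / (x + h))"
        using px by simp
      also have "\<dots> \<le> (a\<^sup>2 * (C / (C + x - 1))) * (1 / x) * ((x + h - 1) / (x + h))"
        using cs rx pos x x0 px0 C Cx h3
        by (intro mult_mono mult_nonneg_nonneg) auto
      also have "\<dots> \<le> ((1 + h)\<^sup>2 / x) * (1 / x) * ((x + h - 1) / (x + h))"
        using aC x0 px0 by (intro mult_right_mono) auto
      finally have 2: "a\<^sup>2 * c / (r * s) * (1 - 1 / p) \<le> ((1 + h)\<^sup>2 / x) * (1 / x) * ((x + h - 1) / (x + h))" .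
      have 3: "a * (a - 1) * (1 / c + 1 / s) \<le> 1 / 3 + 1 / (3 * x)"
        unfolding split using c1 s1[of x] a1 x by linarith
      \<comment> \<open>the double root at \<open>x = 1\<close> is where \<open>3 h (1 + h) = 1\<close> enters\<close>
      have cubic: "2 * x\<^sup>2 * (x + h) - x * (x + h) - 3 * (1 + h)\<^sup>2 * (x + h - 1)
          = (x - 1)\<^sup>2 * (2 * x + 3 * (1 + h)\<^sup>2 * (1 - h))"
        using h(2) by algebra
      have "0 \<le> (x - 1)\<^sup>2 * (2 * x + 3 * (1 + h)\<^sup>2 * (1 - h))"
        using x0 h3 by simp
      then have "x * (x + h) + 3 * (1 + h)\<^sup>2 * (x + h - 1) \<le> 2 * x\<^sup>2 * (x + h)"
        using cubic by linarith
      then have "1 / 3 + 1 / (3 * x) + ((1 + h)\<^sup>2 / x) * (1 / x) * ((x + h - 1) / (x + h)) \<le> 1"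
        using x0 h by (simp add: divide_simps power2_eq_square) (simp add: algebra_simps)
      then show ?thesis using 2 3 by linarith
    qed
  qed
qed

section \<open>Common neighbours and the weight \<open>W\<close>\<close>

definition common_nbrs :: "'a set \<Rightarrow> 'a set set \<Rightarrow> 'a set \<Rightarrow> 'a set" where
  "common_nbrs V E S = {w \<in> V. \<forall>v \<in> S. {v, w} \<in> E}"

abbreviation num_common :: "'a set \<Rightarrow> 'a set set \<Rightarrow> 'a set \<Rightarrow> real" where
  "num_common V E S \<equiv> real (card (common_nbrs V E S))"

lemma simple_graph_edge_neq:
  assumes "simple_graph V E" "{u, v} \<in> E"
  shows "u \<noteq> v"
proof -
  have "{u, v} \<in> [V]\<^bsup>2\<^esup>" using assms unfolding simple_graph_def by blast
  then show ?thesis by simp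
qed

lemma finite_common_nbrs: "simple_graph V E \<Longrightarrow> finite (common_nbrs V E S)"
  by (simp add: simple_graph_def common_nbrs_def)

lemma common_nbrs_notin: "simple_graph V E \<Longrightarrow> w \<in> common_nbrs V E S \<Longrightarrow> w \<notin> S"
  using simple_graph_edge_neq by (fastforce simp: common_nbrs_def)

lemma cliques_containing_clique:
  assumes G: "simple_graph V E" and S: "S \<subseteq> V" "finite S" "clique S E"
  shows "cliques_containing V E (Suc (card S)) S = (\<lambda>w. insert w S) ` common_nbrs V E S"
proof (intro equalityI subsetI)
  fix K assume K: "K \<in> cliques_containing V E (Suc (card S)) S"
  then have "finite K" "S \<subseteq> K" "card K = Suc (card S)" "K \<subseteq> V" "clique K E"
    by (auto simp: cliques_containing_def nsets_def)
  moreover from this have "card (K - S) = 1" using S(2) by (simp add: card_Diff_subset)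
  then obtain w where "K - S = {w}" by (auto simp: card_1_singleton_iff)
  ultimately have "K = insert w S" "w \<in> K" "w \<notin> S" by auto
  moreover from this have "w \<in> common_nbrs V E S"
    using \<open>K \<subseteq> V\<close> \<open>clique K E\<close> by (auto simp: common_nbrs_def clique_def)
  ultimately show "K \<in> (\<lambda>w. insert w S) ` common_nbrs V E S" by blast
next
  fix K assume "K \<in> (\<lambda>w. insert w S) ` common_nbrs V E S"
  then obtain w where w: "w \<in> common_nbrs V E S" "K = insert w S" by blast
  then show "K \<in> cliques_containing V E (Suc (card S)) S"
    using S common_nbrs_notin[OF G w(1)]
    by (auto simp: cliques_containing_def nsets_def common_nbrs_def clique_def insert_commute)
qed

text \<open>Turns the denominators of \<open>W\<close> into counts of common neighbours.\<close>

lemma card_cliques_containing: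
  assumes G: "simple_graph V E" and S: "S \<subseteq> V" "finite S" "clique S E"
  shows "card (cliques_containing V E (Suc (card S)) S) = card (common_nbrs V E S)"
proof -
  have "inj_on (\<lambda>w. insert w S) (common_nbrs V E S)"
    using common_nbrs_notin[OF G] by (intro inj_onI) blast
  then show ?thesis by (simp add: cliques_containing_clique[OF assms] card_image)
qed

lemma W_four:
  assumes G: "simple_graph V E" and K: "[v1, v2, v3, v4] \<in> ordered_cliques V E 4"
  shows "W V E [v1, v2, v3, v4] =
    1 / (num_common V E {v1, v2} * num_common V E {v1, v2, v3} * num_common V E {v1, v2, v3, v4})"
proof -
  have "{2..length [v1, v2, v3, v4]} = {2, 3, 4}" by auto
  moreover have "card (cliques_containing V E 3 {v1, v2}) = card (common_nbrs V E {v1, v2})"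
    "card (cliques_containing V E 4 {v1, v2, v3}) = card (common_nbrs V E {v1, v2, v3})"
    "card (cliques_containing V E 5 {v1, v2, v3, v4}) = card (common_nbrs V E {v1, v2, v3, v4})"
    using card_cliques_containing[OF G, of "{v1, v2}"] card_cliques_containing[OF G, of "{v1, v2, v3}"]
      card_cliques_containing[OF G, of "{v1, v2, v3, v4}"] K
    by (auto simp: ordered_cliques_def clique_def eval_nat_numeral)
  ultimately show ?thesis
    by (simp add: W_def del: list.size)
qed

section \<open>Inequalities between counts of common neighbours\<close>

text \<open>Inclusion-exclusion: the two neighbour sets intersect in that of
  \<open>A \<union> B\<close>, and their union lies in that of \<open>A \<inter> B\<close>.\<close>

lemma num_common_supermodular:
  assumes "simple_graph V E"
  shows "num_common V E A + num_common V E B \<le> num_common V E (A \<union> B) + num_common V E (A \<inter> B)"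
proof -
  have fin: "finite (common_nbrs V E S)" for S using assms by (rule finite_common_nbrs)
  have "card (common_nbrs V E A) + card (common_nbrs V E B)
      = card (common_nbrs V E A \<union> common_nbrs V E B) + card (common_nbrs V E A \<inter> common_nbrs V E B)"
    using fin fin by (rule card_Un_Int)
  also have "\<dots> \<le> card (common_nbrs V E (A \<inter> B)) + card (common_nbrs V E (A \<union> B))"
    using fin by (intro add_mono card_mono) (auto simp: common_nbrs_def)
  finally show ?thesis by linarith
qed

lemma num_common_antimono:
  assumes "simple_graph V E" "A \<subseteq> B"
  shows "num_common V E B \<le> num_common V E A"
  using assms finite_common_nbrs[OF assms(1)]
  by (auto intro!: card_mono simp: common_nbrs_def)

text \<open>Supermodularity for \<open>S\<close> and \<open>{v}\<close>, whose intersection is empty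
  and so has all of \<open>V\<close> as common neighbours.\<close>

lemma num_common_insert:
  assumes G: "simple_graph V E" and "v \<in> V" "v \<notin> S"
    and d: "real (min_degree V E) \<ge> (1 - d) * real (card V)"
  shows "num_common V E S - d * real (card V) \<le> num_common V E (insert v S)"
proof -
  have "min_degree V E \<le> degree V E v"
    using G \<open>v \<in> V\<close> by (simp add: min_degree_def simple_graph_def)
  moreover have "degree V E v = card (common_nbrs V E {v})"
    by (simp add: degree_def common_nbrs_def insert_commute)
  ultimately have "(1 - d) * real (card V) \<le> num_common V E {v}" using d by linarith
  moreover have "common_nbrs V E {} = V" by (simp add: common_nbrs_def)
  ultimately show ?thesis using num_common_supermodular[OF G, of S "{v}"] \<open>v \<notin> S\<close>
    by (simp add: algebra_simps)
qed

section \<open>Grouping the ordered 5-cliques by the two extra vertices\<close>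

text \<open>Disjointness is required by list position, so functions never have to be compared for
  equality.\<close>

lemma sum_list_images:
  assumes "finite P" "\<forall>f \<in> set fs. inj_on f P" "sorted_wrt (\<lambda>f g. f ` P \<inter> g ` P = {}) fs"
  shows "sum g (\<Union>f \<in> set fs. f ` P) = (\<Sum>f \<leftarrow> fs. \<Sum>p \<in> P. g (f p))"
  using assms(2,3)
proof (induction fs)
  case (Cons f fs)
  have "f ` P \<inter> (\<Union>g \<in> set fs. g ` P) = {}" using Cons.prems by fastforce
  then show ?case using Cons assms(1) by (simp add: sum.union_disjoint sum.reindex)
qed simp

lemma ordered_cliques_cong:
  assumes "set vs = set us" "length vs = length us"
  shows "vs \<in> ordered_cliques V E r \<longleftrightarrow> us \<in> ordered_cliques V E r"
  using assms by (metis (mono_tags, lifting) ordered_cliques_def card_distinct distinct_card mem_Collect_eq)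

text \<open>\<open>y\<close> always precedes \<open>z\<close>; the opposite order arises from the
  pair \<open>(z, y)\<close>.\<close>

definition insertions :: "'a \<Rightarrow> 'a \<Rightarrow> 'a \<Rightarrow> ('a \<times> 'a \<Rightarrow> 'a list) list" where
  "insertions x1 x2 x3 =
    [\<lambda>(y, z). [x1, x2, x3, y, z], \<lambda>(y, z). [x1, x2, y, x3, z], \<lambda>(y, z). [x1, x2, y, z, x3],
     \<lambda>(y, z). [x1, y, x2, x3, z], \<lambda>(y, z). [x1, y, x2, z, x3], \<lambda>(y, z). [x1, y, z, x2, x3],
     \<lambda>(y, z). [y, x1, x2, x3, z], \<lambda>(y, z). [y, x1, x2, z, x3], \<lambda>(y, z). [y, x1, z, x2, x3],
     \<lambda>(y, z). [y, z, x1, x2, x3]]"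

lemma ordered_cliques_over_eq:
  fixes V :: "'a set" and E and x1 x2 x3 :: 'a
  defines "P \<equiv> {(y, z). [x1, x2, x3, y, z] \<in> ordered_cliques V E 5}"
  shows "ordered_cliques_over V E 5 [x1, x2, x3] = (\<Union>f \<in> set (insertions x1 x2 x3). f ` P)"
proof (intro equalityI subsetI)
  fix vs assume vs: "vs \<in> ordered_cliques_over V E 5 [x1, x2, x3]"
  then have "length vs = Suc (Suc (Suc (Suc (Suc 0))))"
    by (simp add: ordered_cliques_over_def ordered_cliques_def)
  then obtain a b c d e where abc: "vs = [a, b, c, d, e]"
    unfolding length_Suc_conv length_0_conv by blast
  have sub: "subseq [x1, x2, x3] [a, b, c, d, e]" and cl: "[a, b, c, d, e] \<in> ordered_cliques V E 5"
    using vs unfolding abc ordered_cliques_over_def by blast+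
  have "(a = x1 \<and> b = x2 \<and> c = x3) \<or> (a = x1 \<and> b = x2 \<and> d = x3) \<or> (a = x1 \<and> b = x2 \<and> e = x3)
      \<or> (a = x1 \<and> c = x2 \<and> d = x3) \<or> (a = x1 \<and> c = x2 \<and> e = x3) \<or> (a = x1 \<and> d = x2 \<and> e = x3)
      \<or> (b = x1 \<and> c = x2 \<and> d = x3) \<or> (b = x1 \<and> c = x2 \<and> e = x3) \<or> (b = x1 \<and> d = x2 \<and> e = x3)
      \<or> (c = x1 \<and> d = x2 \<and> e = x3)"
    using sub by (simp split: if_split_asm)
  then have "\<exists>f \<in> set (insertions x1 x2 x3). \<exists>y z. [a, b, c, d, e] = f (y, z)"
    unfolding insertions_def by simp
  then obtain f y z where f: "f \<in> set (insertions x1 x2 x3)" "[a, b, c, d, e] = f (y, z)"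
    by blast
  moreover have "set (f (y, z)) = set [x1, x2, x3, y, z]" "length (f (y, z)) = length [x1, x2, x3, y, z]"
    using f(1) by (auto simp: insertions_def)
  ultimately have "(y, z) \<in> P"
    using cl ordered_cliques_cong[of "[a, b, c, d, e]" "[x1, x2, x3, y, z]"] by (simp add: P_def)
  then show "vs \<in> (\<Union>f \<in> set (insertions x1 x2 x3). f ` P)"
    using f abc by (intro UN_I[of f] image_eqI[of _ _ "(y, z)"]) auto
next
  fix vs assume "vs \<in> (\<Union>f \<in> set (insertions x1 x2 x3). f ` P)"
  then obtain f p where "f \<in> set (insertions x1 x2 x3)" "vs = f p" "p \<in> P"
    by (elim UN_E imageE)
  moreover obtain y z where "p = (y, z)" by (rule prod.exhaust)
  ultimately have f: "f \<in> set (insertions x1 x2 x3)" "vs = f (y, z)" "(y, z) \<in> P" by simp_all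
  have "set vs = set [x1, x2, x3, y, z]" "length vs = length [x1, x2, x3, y, z]" "subseq [x1, x2, x3] vs"
    using f(1,2) by (auto simp: insertions_def)
  then show "vs \<in> ordered_cliques_over V E 5 [x1, x2, x3]"
    using f(3) ordered_cliques_cong[of vs "[x1, x2, x3, y, z]"]
    by (simp add: ordered_cliques_over_def P_def del: subseq_Cons2_iff)
qed

lemma ordered_cliques_sub:
  assumes "vs \<in> ordered_cliques V E r" "set us \<subseteq> set vs" "distinct us" "length us = m"
  shows "us \<in> ordered_cliques V E m"
  using assms by (auto simp: ordered_cliques_def clique_def)

text \<open>Three times the \<open>psi\<close>-weighted sum of the ten values of \<open>W\<close>:
  coefficients \<open>1/3\<close> become 1, and the six terms with \<open>-1/6\<close> merge in
  pairs into three with coefficient -1.\<close>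

definition pair_weight :: "('a set \<Rightarrow> real) \<Rightarrow> 'a \<Rightarrow> 'a \<Rightarrow> 'a \<Rightarrow> 'a \<Rightarrow> 'a \<Rightarrow> real" where
  "pair_weight n x1 x2 x3 y z =
    1 / (n {x1, x2} * n {x1, x2, x3} * n {x1, x2, x3, y})
    + 1 / (n {x1, x2} * n {x1, x2, y} * n {x1, x2, x3, y})
    + 1 / (n {x1, x2} * n {x1, x2, y} * n {x1, x2, y, z})
    + 1 / (n {y, z} * n {x1, y, z} * n {x1, x2, y, z})
    - 1 / (n {x1, y} * n {x1, x2, y} * n {x1, x2, x3, y})
    - 1 / (n {x1, y} * n {x1, x2, y} * n {x1, x2, y, z})
    - 1 / (n {x1, y} * n {x1, y, z} * n {x1, x2, y, z})"

lemma sum_weights_eq: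
  fixes V :: "'a set" and E and x1 x2 x3 :: 'a
  defines "P \<equiv> {(y, z). [x1, x2, x3, y, z] \<in> ordered_cliques V E 5}"
    and "n \<equiv> num_common V E"
  assumes G: "simple_graph V E"
  shows "(\<Sum>vs \<in> ordered_cliques_over V E 5 [x1, x2, x3]. W V E (take 4 vs) * psi vs [x1, x2, x3])
    = (\<Sum>(y, z) \<in> P. 1 / 3 * pair_weight n x1 x2 x3 y z)" (is "?lhs = ?rhs")
proof -
  define g where "g vs = W V E (take 4 vs) * psi vs [x1, x2, x3]" for vs
  have dist: "distinct [x1, x2, x3, y, z]" if "(y, z) \<in> P" for y z
    using that by (simp add: P_def ordered_cliques_def)
  have "P \<subseteq> V \<times> V" by (auto simp: P_def ordered_cliques_def)
  then have "finite P" using G by (auto simp: simple_graph_def intro: finite_subset)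
  moreover have "\<forall>f \<in> set (insertions x1 x2 x3). inj_on f P"
    by (auto simp: insertions_def inj_on_def)
  moreover have "sorted_wrt (\<lambda>f g. f ` P \<inter> g ` P = {}) (insertions x1 x2 x3)"
    by (auto simp: insertions_def disjoint_iff dest!: dist)
  ultimately have "?lhs = (\<Sum>f \<leftarrow> insertions x1 x2 x3. \<Sum>p \<in> P. g (f p))"
    unfolding ordered_cliques_over_eq P_def[symmetric] g_def by (rule sum_list_images)
  also have "\<dots> = (\<Sum>p \<in> P. \<Sum>f \<leftarrow> insertions x1 x2 x3. g (f p))"
    by (simp add: insertions_def sum.distrib)
  also have "\<dots> = ?rhs"
  proof (intro sum.cong refl, clarify)
    fix y z assume yz: "(y, z) \<in> P"
    \<comment> \<open>Any four of the five vertices, in any order, form an ordered clique, so one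
      formula serves all ten interleavings.\<close>
    have W: "W V E [a, b, c, d] = 1 / (n {a, b} * n {a, b, c} * n {a, b, c, d})"
      if "{a, b, c, d} \<subseteq> {x1, x2, x3, y, z}" "distinct [a, b, c, d]" for a b c d
      unfolding n_def
      using ordered_cliques_sub[of "[x1, x2, x3, y, z]" V E 5 "[a, b, c, d]" 4] that yz
      by (intro W_four[OF G]) (simp add: P_def)
    have "x1 \<noteq> x2" "x1 \<noteq> x3" "x1 \<noteq> y" "x1 \<noteq> z" "x2 \<noteq> x3" "x2 \<noteq> y" "x2 \<noteq> z" "x3 \<noteq> y" "x3 \<noteq> z" "y \<noteq> z"
      using dist[OF yz] by auto
    note ne = this this[symmetric]
    show "(\<Sum>f \<leftarrow> insertions x1 x2 x3. g (f (y, z))) = 1 / 3 * pair_weight n x1 x2 x3 y z"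
      by (simp add: insertions_def pair_weight_def g_def psi_def W ne Int_insert_right insert_commute algebra_simps)
  qed
  finally show ?thesis .
qed

section \<open>Nonnegativity for a single pair\<close>

text \<open>Here \<open>t = n{x\<^sub>1, x\<^sub>2, x\<^sub>3}\<close>, \<open>k = n{x\<^sub>1, x\<^sub>2, x\<^sub>3, y}\<close> and \<open>H = d |V|\<close>; the other letters are
  as in \<open>local_weight_bound\<close>, without the normalisation \<open>q = 1\<close>.\<close>

lemma reciprocal_combination_nonneg:
  fixes h H a p q c r s t k :: real
  assumes h: "0 < h" "3 * h * (1 + h) = 1" and H: "H \<le> h * q"
    and pos: "0 < q" "0 < a" "0 < p" "0 < t" "0 < k"
    and a: "a \<le> q + H" and p: "p \<le> q + H"
    and c: "a - H \<le> c" "q - H \<le> c" and r: "p - H \<le> r" "q - H \<le> r"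
    and s: "c + r - q \<le> s" and t: "t \<le> a" and k: "k \<le> c"
  shows "0 \<le> 1 / (a * t * k) + 1 / (a * c * k) + 1 / (a * c * s) + 1 / (p * r * s)
    - 1 / (q * c * k) - 1 / (q * c * s) - 1 / (q * r * s)"
proof -
  \<comment> \<open>The terms containing \<open>1 / k\<close> have total coefficient at least
    \<open>B\<close>, since \<open>t \<le> a\<close>. The first local bound gives
    \<open>B \<ge> 0\<close>, so \<open>k\<close> may be raised to \<open>c\<close>; the second
    bounds the remaining terms by \<open>B / c\<close>.\<close>
  define B where "B = 1 / a\<^sup>2 - (1 / q - 1 / a) / c"
  have c0: "0 < c" using k pos by linarith
  have Hq: "H / q \<le> h" using H pos by (simp add: pos_divide_le_eq)
  have scale: "a / q \<le> 1 + h" "p / q \<le> 1 + h" "a / q - h \<le> c / q" "1 - h \<le> c / q"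
    "p / q - h \<le> r / q" "1 - h \<le> r / q" "c / q + r / q - 1 \<le> s / q"
    using divide_right_mono[OF a, of q] divide_right_mono[OF p, of q] divide_right_mono[OF c(1), of q]
      divide_right_mono[OF c(2), of q] divide_right_mono[OF r(1), of q] divide_right_mono[OF r(2), of q]
      divide_right_mono[OF s, of q] pos Hq
    by (simp_all add: add_divide_distrib diff_divide_distrib)
  note L = local_weight_bound[OF h _ _ scale]
  \<comment> \<open>Makes the lower bound \<open>1 - 2 * h\<close> for \<open>s / q\<close>
    positive.\<close>
  have "h < 1 / 2"
  proof (rule ccontr)
    assume "\<not> h < 1 / 2"
    then have "(1 / 2) * (3 / 2) \<le> h * (1 + h)" by (intro mult_mono) auto
    then show False using h by (simp add: algebra_simps)
  qed
  then have "0 < r / q" "0 < s / q" using scale by linarith+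
  then have rs: "0 < r" "0 < s" using pos by (simp_all add: zero_less_divide_iff)
  have "(a / q) * (a / q - 1) / (c / q) \<le> 1" using pos by (intro L(1)) auto
  also have "(a / q) * (a / q - 1) / (c / q) = a\<^sup>2 * (1 / q - 1 / a) / c"
    using pos c0 by (simp add: divide_simps power2_eq_square)
  finally have "0 \<le> (1 - a\<^sup>2 * (1 / q - 1 / a) / c) / a\<^sup>2" by simp
  also have "\<dots> = B" using pos by (simp add: B_def diff_divide_distrib)
  finally have B0: "0 \<le> B" .
  have "(a / q) * (a / q - 1) * (1 / (c / q) + 1 / (s / q))
      + (a / q)\<^sup>2 * (c / q) / ((r / q) * (s / q)) * (1 - 1 / (p / q)) \<le> 1"
    using pos by (intro L(2)) auto
  also have "(a / q) * (a / q - 1) * (1 / (c / q) + 1 / (s / q))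
      + (a / q)\<^sup>2 * (c / q) / ((r / q) * (s / q)) * (1 - 1 / (p / q))
      = a\<^sup>2 * c * ((1 / q - 1 / a) / c * (1 / c + 1 / s) + (1 / q - 1 / p) / (r * s))"
    using pos c0 rs by (simp add: field_simps power2_eq_square)
  finally have "(1 / q - 1 / a) / c * (1 / c + 1 / s) + (1 / q - 1 / p) / (r * s) \<le> 1 / (a\<^sup>2 * c)"
    using pos c0 by (simp add: pos_le_divide_eq mult.commute)
  then have "(1 / q - 1 / a) / (c * s) + (1 / q - 1 / p) / (r * s) \<le> B / c"
    by (simp add: B_def algebra_simps diff_divide_distrib add_divide_distrib)
  also have "\<dots> \<le> B / k" using B0 k pos by (intro divide_left_mono) auto
  also have "\<dots> \<le> (1 / (a * t) - (1 / q - 1 / a) / c) / k"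
    unfolding B_def using pos t
    by (intro divide_right_mono diff_right_mono divide_left_mono) (auto simp: power2_eq_square)
  finally show ?thesis
    by (simp add: algebra_simps diff_divide_distrib add_divide_distrib)
qed

section \<open>From the minimum degree to the sign of \<open>w_G\<close>\<close>

theorem theorem3p17:
  fixes V :: "'a set" and E :: "'a set set" and x1 x2 x3 :: 'a and d :: real
  assumes "simple_graph V E"
    and "d = (7 - sqrt 21) / 14"
    and "real (min_degree V E) \<ge> (1 - d) * real (card V)"
    and "[x1, x2, x3] \<in> ordered_cliques V E 3"
  shows "w_G1 V E [x1, x2, x3] \<le> 1"
proof -
  note G = assms(1)
  define n where "n = num_common V E"
  define H where "H = d * real (card V)"
  define h where "h = d / (1 - 2 * d)"
  have "x1 \<in> V" using assms(4) by (simp add: ordered_cliques_def)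
  then have V0: "0 < real (card V)" using G by (auto simp: simple_graph_def card_gt_0_iff)
  have sq: "sqrt 21 * sqrt 21 = 21" by simp
  have "sqrt 21 < 5" by (rule real_less_lsqrt) auto
  then have d0: "0 < d" using assms(2) by simp
  have d2: "1 - 2 * d = sqrt 21 / 7" using assms(2) by (simp add: field_simps)
  \<comment> \<open>Rearranged \<open>7 * d * (1 - d) = 1\<close>. Since
    \<open>1 + h = (1 - d) / (1 - 2 * d)\<close>, dividing by the right side gives
    \<open>3 * h * (1 + h) = 1\<close>.\<close>
  have d3: "3 * d * (1 - d) = (1 - 2 * d)\<^sup>2"
    using sq unfolding assms(2) by (simp add: field_simps power2_eq_square)
  have d1: "0 < 1 - 2 * d" unfolding d2 by simp
  have h: "0 < h" "3 * h * (1 + h) = 1"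
    using d0 d1 d3 by (simp_all add: h_def field_simps power2_eq_square)
  have ins: "n S - H \<le> n (insert v S)" if "v \<in> V" "v \<notin> S" for v S
    unfolding n_def H_def by (rule num_common_insert[OF G that assms(3)])
  have anti: "n B \<le> n A" if "A \<subseteq> B" for A B
    unfolding n_def by (rule num_common_antimono[OF G that])
  have n_pos: "0 < n S" if "w \<in> V" "\<forall>v \<in> S. {v, w} \<in> E" for w S
    using that finite_common_nbrs[OF G, of S] by (auto simp: n_def card_gt_0_iff common_nbrs_def)
  have nonneg: "0 \<le> pair_weight n x1 x2 x3 y z" if "[x1, x2, x3, y, z] \<in> ordered_cliques V E 5" for y z
  proof -
    have dist: "distinct [x1, x2, x3, y, z]" and inV: "{x1, x2, x3, y, z} \<subseteq> V"
      and cl: "clique {x1, x2, x3, y, z} E"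
      using that by (auto simp: ordered_cliques_def)
    \<comment> \<open>Starting from the empty set, each of the two vertices costs at most
      \<open>H\<close>.\<close>
    have q: "(1 - 2 * d) * real (card V) \<le> n {x1, y}"
    proof -
      have "n {} = real (card V)" by (simp add: n_def common_nbrs_def)
      then show ?thesis using ins[of y "{}"] ins[of x1 "{y}"] dist inV
        by (simp add: H_def algebra_simps)
    qed
    moreover have "H = h * ((1 - 2 * d) * real (card V))" using d1 by (simp add: H_def h_def)
    ultimately have H: "H \<le> h * n {x1, y}" using h by simp
    have q0: "0 < n {x1, y}" using q mult_pos_pos[OF d1 V0] by linarith
    \<comment> \<open>Another vertex of the 5-clique is a common neighbour in each case.\<close>
    have pos: "0 < n {x1, x2}" "0 < n {y, z}" "0 < n {x1, x2, x3}" "0 < n {x1, x2, x3, y}"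
      using n_pos[of z "{x1, x2}"] n_pos[of x1 "{y, z}"] n_pos[of z "{x1, x2, x3}"]
        n_pos[of z "{x1, x2, x3, y}"] dist inV cl
      by (auto simp: clique_def)
    \<comment> \<open>Compare through the shared vertex:
      \<open>n {x1, x2} \<le> n {x1} \<le> n {x1, y} + H\<close>; for \<open>p\<close> the shared
      vertex is \<open>y\<close>.\<close>
    have a: "n {x1, x2} \<le> n {x1, y} + H"
      using anti[of "{x1}" "{x1, x2}"] ins[of y "{x1}"] dist inV by (auto simp: insert_commute)
    have p: "n {y, z} \<le> n {x1, y} + H"
      using anti[of "{y}" "{y, z}"] ins[of x1 "{y}"] dist inV by auto
    have c: "n {x1, x2} - H \<le> n {x1, x2, y}" "n {x1, y} - H \<le> n {x1, x2, y}"
      using ins[of y "{x1, x2}"] ins[of x2 "{x1, y}"] dist inV by (auto simp: insert_commute)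
    have r: "n {y, z} - H \<le> n {x1, y, z}" "n {x1, y} - H \<le> n {x1, y, z}"
      using ins[of x1 "{y, z}"] ins[of z "{x1, y}"] dist inV by (auto simp: insert_commute)
    have "{x1, x2, y} \<union> {x1, y, z} = {x1, x2, y, z}" by auto
    moreover have "{x1, x2, y} \<inter> {x1, y, z} = {x1, y}" using dist by auto
    ultimately have s: "n {x1, x2, y} + n {x1, y, z} - n {x1, y} \<le> n {x1, x2, y, z}"
      using num_common_supermodular[OF G, of "{x1, x2, y}" "{x1, y, z}"] by (simp add: n_def)
    have tk: "n {x1, x2, x3} \<le> n {x1, x2}" "n {x1, x2, x3, y} \<le> n {x1, x2, y}"
      by (auto intro!: anti)
    show ?thesis
      unfolding pair_weight_def by (rule reciprocal_combination_nonneg[OF h H q0 pos a p c r s tk])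
  qed
  have "0 \<le> (\<Sum>vs \<in> ordered_cliques_over V E 5 [x1, x2, x3]. W V E (take 4 vs) * psi vs [x1, x2, x3])"
    unfolding sum_weights_eq[OF G] n_def[symmetric] by (rule sum_nonneg) (auto intro: nonneg)
  then show ?thesis by (simp add: w_G1_def w_G_def)
qed

end
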